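(* Let $A$ be a non-empty set and let $\mathcal R$ be a locally closed set of relations of various (finite) arities on $A$ containing the empty relation. The following are equivalent: (i) $\mathcal R$ contains the binary equality relation $=_A$ and is closed under formation of tight conjunctive minors; (ii) $\mathcal R$ contains the full unary relation $A^1$ and is closed under general superpositions.
   Context: Positive integers are identified with $n=\{0,\dots,n-1\}$; an $m$-tuple is a map $m\to A$, and an $m$-ary relation on $A$ is a subset of $A^m$. The empty relation is $\emptyset$ (of some arity). $\mathcal R$ is locally closed if for every relation $R$ on $A$: whenever for every finite subset $F\subseteq R$ there is $R'\in\mathcal R$ with $F\subseteq R'\subseteq R$, then $R\in\mathcal R$. Tight conjunctive minors: let $m$ be a positive integer, $V$ a set disjoint from the natural numbers, and $H=(h_j)_{j\in J}$ a non-empty family of maps $h_j:n_j\to m\cup V$ ($n_j$ positive integers). For $\mathbf a\in A^m$ and $\sigma:V\to A$, $\mathbf a+\sigma:m\cup V\to A$ agrees with $\mathbf a$ on $m$ and with $\sigma$ on $V$. For relations $R_j\subseteq A^{n_j}$, the tight conjunctive minor of $(R_j)_{j\in J}$ via $H$ is $\{\mathbf a\in A^m:\exists \sigma:V\to A \text{ with } (\mathbf a+\sigma)\circ h_j\in R_j \text{ for all } j\in J\}$. $\mathcal R$ is closed under formation of tight conjunctive minors if for every non-empty family of members of $\mathcal R$ and every such scheme $H$ (finite $m,n_j$, arbitrary $J,V$), the tight conjunctive minor is in $\mathcal R$. General superposition: given a non-empty family $(R_j)_{j\in J}$ of relations on $A$ with $R_j$ of arity $n_j$, a non-empty set $B$,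 a positive integer $m$, $\mathbf b\in B^m$ and $\mathbf b_j\in B^{n_j}$ for each $j$, the $m$-ary relation obtained by general superposition with respect to $\mathbf b$ and $(\mathbf b_j)_{j\in J}$ is $\{f\circ\mathbf b: f:B\to A,\ f\circ\mathbf b_j\in R_j \text{ for all } j\in J\}$. $\mathcal R$ is closed under general superpositions if every relation obtained in this way from a non-empty family of members of $\mathcal R$ (for any such $B$, $\mathbf b$, $(\mathbf b_j)$) is in $\mathcal R$. *)

theory Defs
  imports Main "HOL-Library.FuncSet"
begin

text \<open>An \<open>n\<close>-tuple over \<open>A\<close>, i.e. a map from \<open>{0, ..., n - 1}\<close> to \<open>A\<close>, is a list of length \<open>n\<close>;
  composition \<open>f \<circ> b\<close> with a tuple \<open>b\<close> is \<open>map f b\<close>. A relation is a plain set of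
  tuples, so that the empty set is a relation of every arity.\<close>

definition tuples :: "'a set \<Rightarrow> nat \<Rightarrow> 'a list set" where
  "tuples A n = {xs. length xs = n \<and> set xs \<subseteq> A}"

definition relation_on :: "'a set \<Rightarrow> 'a list set \<Rightarrow> bool" where
  "relation_on A R \<longleftrightarrow> (\<exists>m>0. R \<subseteq> tuples A m)"

definition equality_rel :: "'a set \<Rightarrow> 'a list set" where
  "equality_rel A = {[x, x] | x. x \<in> A}"

definition locally_closed :: "'a set \<Rightarrow> 'a list set set \<Rightarrow> bool" where
  "locally_closed A \<R> \<longleftrightarrow>
     (\<forall>R. relation_on A R \<longrightarrow>
        (\<forall>F. finite F \<and> F \<subseteq> R \<longrightarrow> (\<exists>R'\<in>\<R>. F \<subseteq> R' \<and> R' \<subseteq> R)) \<longrightarrow> R \<in> \<R>)"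

text \<open>The disjoint union of \<open>m = {0, ..., m - 1}\<close> and \<open>V\<close> is \<open>{..<m} <+> V\<close>, and
  \<open>case_sum ((!) a) \<sigma>\<close> is the map \<open>a + \<sigma>\<close> on it.\<close>

definition tight_minor ::
  "'a set \<Rightarrow> nat \<Rightarrow> 'v set \<Rightarrow> 'j set \<Rightarrow> ('j \<Rightarrow> (nat + 'v) list) \<Rightarrow> ('j \<Rightarrow> 'a list set) \<Rightarrow> 'a list set"
where
  "tight_minor A m V J h R =
     {a \<in> tuples A m. \<exists>\<sigma>\<in>V \<rightarrow> A. \<forall>j\<in>J. map (case_sum ((!) a) \<sigma>) (h j) \<in> R j}"

definition general_superposition ::
  "'a set \<Rightarrow> 'b set \<Rightarrow> 'b list \<Rightarrow> 'j set \<Rightarrow> ('j \<Rightarrow> 'b list) \<Rightarrow> ('j \<Rightarrow> 'a list set) \<Rightarrow> 'a list set"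
where
  "general_superposition A B b J bs R =
     {map f b | f. f \<in> B \<rightarrow> A \<and> (\<forall>j\<in>J. map f (bs j) \<in> R j)}"

text \<open>Closure for all index sets \<open>J\<close> and all sets \<open>V\<close> (resp. \<open>B\<close>) of given types.\<close>

definition closed_tight_minors_at ::
  "'j itself \<Rightarrow> 'v itself \<Rightarrow> 'a set \<Rightarrow> 'a list set set \<Rightarrow> bool" where
  "closed_tight_minors_at _ _ A \<R> \<longleftrightarrow>
     (\<forall>m (V :: 'v set) (J :: 'j set) n h R.
        0 < m \<and> J \<noteq> {} \<and>
        (\<forall>j\<in>J. 0 < n j \<and> h j \<in> tuples ({..<m} <+> V) (n j) \<and>
               R j \<in> \<R> \<and> R j \<subseteq> tuples A (n j)) \<longrightarrow>
        tight_minor A m V J h R \<in> \<R>)"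

definition closed_superpositions_at ::
  "'j itself \<Rightarrow> 'b itself \<Rightarrow> 'a set \<Rightarrow> 'a list set set \<Rightarrow> bool" where
  "closed_superpositions_at _ _ A \<R> \<longleftrightarrow>
     (\<forall>m (B :: 'b set) b (J :: 'j set) n bs R.
        0 < m \<and> B \<noteq> {} \<and> b \<in> tuples B m \<and> J \<noteq> {} \<and>
        (\<forall>j\<in>J. 0 < n j \<and> bs j \<in> tuples B (n j) \<and>
               R j \<in> \<R> \<and> R j \<subseteq> tuples A (n j)) \<longrightarrow>
        general_superposition A B b J bs R \<in> \<R>)"

text \<open>HOL cannot quantify over types inside a formula. We therefore use types of sets \<open>J\<close>, \<open>V\<close>
  and \<open>B\<close> that are large enough to account for sets of every type: see
  \<open>closed_tight_minors_imp_at\<close> and \<open>closed_superpositions_imp_at\<close> below, which hold for arbitrary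
  types \<open>'j\<close>, \<open>'v\<close> and \<open>'b\<close>. The reason is that points of \<open>V\<close> (or \<open>B\<close>) on which one chosen
  system of witnesses, one for each tuple of the resulting relation, always agrees can be
  identified without changing that relation.\<close>

definition closed_tight_minors :: "'a set \<Rightarrow> 'a list set set \<Rightarrow> bool" where
  "closed_tight_minors A \<R> \<longleftrightarrow>
     closed_tight_minors_at
       TYPE('a list set \<times> (nat + ('a list \<Rightarrow> 'a)) list) TYPE('a list \<Rightarrow> 'a) A \<R>"

definition closed_superpositions :: "'a set \<Rightarrow> 'a list set set \<Rightarrow> bool" where
  "closed_superpositions A \<R> \<longleftrightarrow>
     closed_superpositions_at
       TYPE('a list set \<times> ('a list \<Rightarrow> 'a) list) TYPE('a list \<Rightarrow> 'a) A \<R>"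

lemma closed_tight_minors_imp_at:
  assumes "closed_tight_minors A \<R>"
  shows "closed_tight_minors_at TYPE('j) TYPE('v) A \<R>"
  unfolding closed_tight_minors_at_def
proof (intro allI impI)
  fix m :: nat and V :: "'v set" and J :: "'j set" and n h R
  assume asm: "0 < m \<and> J \<noteq> {} \<and>
    (\<forall>j\<in>J. 0 < n j \<and> h j \<in> tuples ({..<m} <+> V) (n j) \<and> R j \<in> \<R> \<and> R j \<subseteq> tuples A (n j))"
  define S where "S = tight_minor A m V J h R"
  have "\<forall>a\<in>S. \<exists>\<sigma>. \<sigma> \<in> V \<rightarrow> A \<and> (\<forall>j\<in>J. map (case_sum ((!) a) \<sigma>) (h j) \<in> R j)"
    by (auto simp: S_def tight_minor_def)
  then obtain s where s: "\<And>a. a \<in> S \<Longrightarrow> s a \<in> V \<rightarrow> A"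
    "\<And>a j. a \<in> S \<Longrightarrow> j \<in> J \<Longrightarrow> map (case_sum ((!) a) (s a)) (h j) \<in> R j"
    by metis
  define q where "q v = (\<lambda>a. if a \<in> S then s a v else undefined)" for v
  define k where "k j = (R j, map (map_sum id q) (h j))" for j
  have comp: "case_sum x \<tau> \<circ> map_sum id q = case_sum x (\<tau> \<circ> q)" for x :: "nat \<Rightarrow> 'a" and \<tau>
    by (auto simp: fun_eq_iff split: sum.split)
  have "tight_minor A m (q ` V) (k ` J) snd fst \<in> \<R>"
  proof -
    have "map (map_sum id q) (h j) \<in> tuples ({..<m} <+> q ` V) (n j)" if "j \<in> J" for j
    proof -
      have "h j \<in> tuples ({..<m} <+> V) (n j)" using asm that by blast
      thus ?thesis by (fastforce simp: tuples_def)
    qed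
    moreover have "length (h j) = n j" if "j \<in> J" for j
      using asm that by (auto simp: tuples_def)
    ultimately have "\<forall>i\<in>k ` J. 0 < length (snd i) \<and>
       snd i \<in> tuples ({..<m} <+> q ` V) (length (snd i)) \<and>
       fst i \<in> \<R> \<and> fst i \<subseteq> tuples A (length (snd i))"
      using asm by (fastforce simp: k_def)
    moreover have "0 < m" "k ` J \<noteq> {}" using asm by auto
    ultimately show ?thesis
      using assms[unfolded closed_tight_minors_def closed_tight_minors_at_def,
        rule_format, of m "k ` J" "\<lambda>i. length (snd i)" snd "q ` V" fst] by simp
  qed
  moreover have "tight_minor A m (q ` V) (k ` J) snd fst = S"
  proof (intro equalityI subsetI)
    fix a assume "a \<in> tight_minor A m (q ` V) (k ` J) snd fst"
    then obtain \<tau> where "a \<in> tuples A m" "\<tau> \<in> q ` V \<rightarrow> A"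
      "\<forall>j\<in>J. map (case_sum ((!) a) (\<tau> \<circ> q)) (h j) \<in> R j"
      by (auto simp: tight_minor_def k_def comp)
    moreover from this have "\<tau> \<circ> q \<in> V \<rightarrow> A" by auto
    ultimately show "a \<in> S" unfolding S_def tight_minor_def by blast
  next
    fix a assume a: "a \<in> S"
    define \<tau> where "\<tau> w = w a" for w :: "'a list \<Rightarrow> 'a"
    have "\<tau> \<circ> q = s a" using a by (auto simp: \<tau>_def q_def)
    moreover have "\<tau> \<in> q ` V \<rightarrow> A" using s(1)[OF a] a by (auto simp: \<tau>_def q_def)
    moreover have "a \<in> tuples A m" using a by (simp add: S_def tight_minor_def)
    ultimately show "a \<in> tight_minor A m (q ` V) (k ` J) snd fst"
      using s(2)[OF a] by (auto simp: tight_minor_def k_def comp intro!: bexI[of _ \<tau>])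
  qed
  ultimately show "tight_minor A m V J h R \<in> \<R>" by (simp add: S_def)
qed

lemma closed_superpositions_imp_at:
  assumes "closed_superpositions A \<R>"
  shows "closed_superpositions_at TYPE('j) TYPE('b) A \<R>"
  unfolding closed_superpositions_at_def
proof (intro allI impI)
  fix m :: nat and B :: "'b set" and b and J :: "'j set" and n bs R
  assume asm: "0 < m \<and> B \<noteq> {} \<and> b \<in> tuples B m \<and> J \<noteq> {} \<and>
    (\<forall>j\<in>J. 0 < n j \<and> bs j \<in> tuples B (n j) \<and> R j \<in> \<R> \<and> R j \<subseteq> tuples A (n j))"
  define S where "S = general_superposition A B b J bs R"
  have "\<forall>r\<in>S. \<exists>f. f \<in> B \<rightarrow> A \<and> r = map f b \<and> (\<forall>j\<in>J. map f (bs j) \<in> R j)"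
    by (auto simp: S_def general_superposition_def)
  then obtain s where s: "\<And>r. r \<in> S \<Longrightarrow> s r \<in> B \<rightarrow> A" "\<And>r. r \<in> S \<Longrightarrow> r = map (s r) b"
    "\<And>r j. r \<in> S \<Longrightarrow> j \<in> J \<Longrightarrow> map (s r) (bs j) \<in> R j"
    by metis
  define q where "q x = (\<lambda>r. if r \<in> S then s r x else undefined)" for x
  define k where "k j = (R j, map q (bs j))" for j
  have "general_superposition A (q ` B) (map q b) (k ` J) snd fst \<in> \<R>"
  proof -
    have "length (bs j) = n j" "set (bs j) \<subseteq> B" if "j \<in> J" for j
      using asm that by (auto simp: tuples_def)
    hence "\<forall>i\<in>k ` J. 0 < length (snd i) \<and> snd i \<in> tuples (q ` B) (length (snd i)) \<and>
       fst i \<in> \<R> \<and> fst i \<subseteq> tuples A (length (snd i))"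
      using asm by (fastforce simp: k_def tuples_def)
    moreover have "0 < m" "k ` J \<noteq> {}" "q ` B \<noteq> {}" "map q b \<in> tuples (q ` B) m"
      using asm by (auto simp: tuples_def)
    ultimately show ?thesis
      using assms[unfolded closed_superpositions_def closed_superpositions_at_def,
        rule_format, of m "q ` B" "map q b" "k ` J" "\<lambda>i. length (snd i)" snd fst] by simp
  qed
  moreover have "general_superposition A (q ` B) (map q b) (k ` J) snd fst = S"
  proof (intro equalityI subsetI)
    fix r assume "r \<in> general_superposition A (q ` B) (map q b) (k ` J) snd fst"
    then obtain f where "r = map (f \<circ> q) b" "f \<in> q ` B \<rightarrow> A"
      "\<forall>j\<in>J. map (f \<circ> q) (bs j) \<in> R j"
      by (auto simp: general_superposition_def k_def)
    moreover from this have "f \<circ> q \<in> B \<rightarrow> A" by auto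
    ultimately show "r \<in> S" unfolding S_def general_superposition_def by blast
  next
    fix r assume r: "r \<in> S"
    define f where "f w = w r" for w :: "'a list \<Rightarrow> 'a"
    have fq: "f \<circ> q = s r" using r by (auto simp: f_def q_def)
    have "f \<in> q ` B \<rightarrow> A" using s(1)[OF r] r by (auto simp: f_def q_def)
    moreover have "r = map f (map q b)" using s(2)[OF r] by (simp add: fq)
    moreover have "\<forall>i\<in>k ` J. map f (snd i) \<in> fst i" using s(3)[OF r] by (simp add: k_def fq)
    ultimately show "r \<in> general_superposition A (q ` B) (map q b) (k ` J) snd fst"
      unfolding general_superposition_def by blast
  qed
  ultimately show "general_superposition A B b J bs R \<in> \<R>" by (simp add: S_def)
qed

end

theory Submission
  imports Defs
begin

text \<open>The two operations simulate each other. A tight conjunctive minor is the general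
  superposition over \<open>B = m \<union> V\<close> with \<open>b\<close> the inclusion of \<open>m\<close>. Conversely, a general superposition
  is the tight conjunctive minor with \<open>V = B\<close> in which \<open>m\<close> further constraints, copies of the equality
  relation, force the \<open>i\<close>-th coordinate of a tuple to be the value of \<open>f\<close> at the \<open>i\<close>-th entry of
  \<open>b\<close>. The equality relation and the full unary relation are obtained from each other by
  repeating a coordinate.\<close>

text \<open>The constraints indexed by \<open>Inl j\<close> mention points of \<open>B\<close> only,
  so one and the same map \<open>f\<close> serves as the map of the superposition and as the witness
  of the minor.\<close>

lemma general_superposition_eq_tight_minor:
  assumes b: "b \<in> tuples B m"
  shows "general_superposition A B b J bs R =
    tight_minor A m B (J <+> {..<m})
      (case_sum (\<lambda>j. map Inr (bs j)) (\<lambda>i. [Inl i, Inr (b ! i)]))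
      (case_sum R (\<lambda>_. equality_rel A))"
    (is "_ = tight_minor A m B ?J ?h ?R")
proof (intro equalityI subsetI)
  fix a assume "a \<in> general_superposition A B b J bs R"
  then obtain f where f: "a = map f b" "f \<in> B \<rightarrow> A" "\<forall>j\<in>J. map f (bs j) \<in> R j"
    by (auto simp: general_superposition_def)
  have "a \<in> tuples A m" using b f(1,2) by (auto simp: tuples_def)
  moreover have "\<forall>j\<in>?J. map (case_sum ((!) a) f) (?h j) \<in> ?R j"
    using b f by (auto simp: tuples_def equality_rel_def comp_def subset_iff Pi_iff)
  ultimately show "a \<in> tight_minor A m B ?J ?h ?R"
    using f(2) unfolding tight_minor_def by blast
next
  fix a assume "a \<in> tight_minor A m B ?J ?h ?R"
  then obtain f where a: "a \<in> tuples A m" and f: "f \<in> B \<rightarrow> A"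
    and *: "\<And>j. j \<in> ?J \<Longrightarrow> map (case_sum ((!) a) f) (?h j) \<in> ?R j"
    unfolding tight_minor_def by blast
  \<comment> \<open>The constraint at index \<open>Inr i\<close> puts the pair of these two values
    into the equality relation.\<close>
  have "a ! i = f (b ! i)" if "i < m" for i
    using *[OF InrI, of i] that by (auto simp: equality_rel_def)
  hence "a = map f b" using a b by (auto simp: tuples_def intro: nth_equalityI)
  moreover have "\<forall>j\<in>J. map f (bs j) \<in> R j"
    using *[OF InlI] by (auto simp: comp_def)
  ultimately show "a \<in> general_superposition A B b J bs R"
    using f unfolding general_superposition_def by blast
qed

text \<open>A map on the disjoint union splits into its part on \<open>m\<close>, which is the tuple
  \<open>a\<close>, and its part on \<open>V\<close>, which is the witness.\<close>

lemma tight_minor_eq_general_superposition: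
  assumes h: "\<And>j. j \<in> J \<Longrightarrow> h j \<in> tuples ({..<m} <+> V) (n j)"
  shows "tight_minor A m V J h R =
    general_superposition A ({..<m} <+> V) (map Inl [0..<m]) J h R"
proof (intro equalityI subsetI)
  fix a assume "a \<in> tight_minor A m V J h R"
  then obtain \<sigma> where a: "a \<in> tuples A m" "\<sigma> \<in> V \<rightarrow> A"
    "\<forall>j\<in>J. map (case_sum ((!) a) \<sigma>) (h j) \<in> R j"
    by (auto simp: tight_minor_def)
  let ?f = "case_sum ((!) a) \<sigma>"
  have "?f \<in> ({..<m} <+> V) \<rightarrow> A" using a(1,2) by (auto simp: tuples_def subset_iff)
  moreover have "a = map ?f (map Inl [0..<m])"
    using a(1) by (auto simp: tuples_def comp_def map_nth)
  ultimately show "a \<in> general_superposition A ({..<m} <+> V) (map Inl [0..<m]) J h R"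
    using a(3) unfolding general_superposition_def by blast
next
  fix a assume "a \<in> general_superposition A ({..<m} <+> V) (map Inl [0..<m]) J h R"
  then obtain f where f: "a = map f (map Inl [0..<m])" "f \<in> ({..<m} <+> V) \<rightarrow> A"
    "\<forall>j\<in>J. map f (h j) \<in> R j"
    by (auto simp: general_superposition_def)
  \<comment> \<open>By \<open>h\<close>, every entry \<open>Inl i\<close> has \<open>i < m\<close>;
    this is the range in which \<open>a ! i\<close> equals \<open>f (Inl i)\<close>.\<close>
  have "map (case_sum ((!) a) (f \<circ> Inr)) (h j) = map f (h j)" if "j \<in> J" for j
    using h[OF that] f(1) by (fastforce simp: tuples_def)
  moreover have "a \<in> tuples A m" "f \<circ> Inr \<in> V \<rightarrow> A" using f(1,2) by (auto simp: tuples_def)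
  ultimately show "a \<in> tight_minor A m V J h R"
    using f(3) unfolding tight_minor_def by (auto simp del: map_eq_conv intro!: bexI[of _ "f \<circ> Inr"])
qed

text \<open>Using coordinate 0 twice in the equality relation gives the condition x = x, which every
  element of \<open>A\<close> satisfies.\<close>

lemma closed_tight_minors_imp_full_unary:
  assumes "equality_rel A \<in> \<R>" "closed_tight_minors A \<R>"
  shows "tuples A 1 \<in> \<R>"
proof -
  let ?h = "\<lambda>_::unit. [Inl 0, Inl 0] :: (nat + unit) list"
  have "tight_minor A 1 {} UNIV ?h (\<lambda>_. equality_rel A) \<in> \<R>"
    using assms(1) closed_tight_minors_imp_at[OF assms(2), where 'j=unit and 'v=unit,
      unfolded closed_tight_minors_at_def, rule_format, of 1 UNIV "\<lambda>_. 2" ?h "{}" "\<lambda>_. equality_rel A"]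
    by (fastforce simp: tuples_def equality_rel_def)
  moreover have "tight_minor A 1 {} UNIV ?h (\<lambda>_. equality_rel A) = tuples A 1"
    by (auto simp: tight_minor_def tuples_def equality_rel_def length_Suc_conv)
  ultimately show ?thesis by simp
qed

text \<open>A map from a one-point set is a single element x of \<open>A\<close>, and repeating the
  point in \<open>b\<close> yields \<open>[x, x]\<close>. The constraint \<open>[x]\<close> in
  \<open>tuples A 1\<close> supplies the non-empty family.\<close>

lemma closed_superpositions_imp_equality:
  assumes "tuples A 1 \<in> \<R>" "closed_superpositions A \<R>"
  shows "equality_rel A \<in> \<R>"
proof -
  let ?S = "general_superposition A UNIV [(), ()] (UNIV :: unit set) (\<lambda>_. [()]) (\<lambda>_. tuples A 1)"
  have "?S \<in> \<R>"
    using assms(1) closed_superpositions_imp_at[OF assms(2), where 'j=unit and 'b=unit,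
      unfolded closed_superpositions_at_def, rule_format,
      of 2 UNIV "[(), ()]" UNIV "\<lambda>_. 1" "\<lambda>_. [()]" "\<lambda>_. tuples A 1"]
    by (auto simp: tuples_def)
  moreover have "?S = equality_rel A"
    by (auto simp: general_superposition_def tuples_def equality_rel_def
      intro: exI[of _ "\<lambda>_. x" for x])
  ultimately show ?thesis by simp
qed

lemma closed_tight_minors_imp_superpositions:
  fixes A :: "'a set"
  assumes eq: "equality_rel A \<in> \<R>" and cl: "closed_tight_minors A \<R>"
  shows "closed_superpositions_at TYPE('j) TYPE('b) A \<R>"
  unfolding closed_superpositions_at_def
proof (intro allI impI)
  fix m :: nat and B :: "'b set" and b and J :: "'j set" and n bs R
  assume asm: "0 < m \<and> B \<noteq> {} \<and> b \<in> tuples B m \<and> J \<noteq> {} \<and>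
    (\<forall>j\<in>J. 0 < n j \<and> bs j \<in> tuples B (n j) \<and> R j \<in> \<R> \<and> R j \<subseteq> tuples A (n j))"
  hence b: "b \<in> tuples B m" by blast
  let ?J = "J <+> {..<m}"
  let ?h = "case_sum (\<lambda>j. map Inr (bs j)) (\<lambda>i. [Inl i, Inr (b ! i)])"
  let ?R = "case_sum R (\<lambda>_. equality_rel A)"
  let ?n = "case_sum n (\<lambda>_. 2)"
  have "0 < ?n j \<and> ?h j \<in> tuples ({..<m} <+> B) (?n j) \<and> ?R j \<in> \<R> \<and> ?R j \<subseteq> tuples A (?n j)"
    if "j \<in> ?J" for j
  proof (cases j)
    case (Inl i)
    hence "0 < n i" "bs i \<in> tuples B (n i)" "R i \<in> \<R>" "R i \<subseteq> tuples A (n i)"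
      using asm that by auto
    thus ?thesis using Inl by (auto simp: tuples_def)
  next
    case (Inr i)
    thus ?thesis using that b eq by (auto simp: tuples_def equality_rel_def)
  qed
  moreover have "0 < m" "?J \<noteq> {}" using asm by auto
  ultimately have "tight_minor A m B ?J ?h ?R \<in> \<R>"
    \<comment> \<open>The enlarged index set lives in the type \<open>'j + nat\<close>, hence the
      transfer of closure to arbitrary types.\<close>
    using closed_tight_minors_imp_at[OF cl, where 'j="'j + nat" and 'v='b,
      unfolded closed_tight_minors_at_def, rule_format, of m ?J ?n ?h B ?R] by blast
  thus "general_superposition A B b J bs R \<in> \<R>"
    by (simp only: general_superposition_eq_tight_minor[OF b])
qed

lemma closed_superpositions_imp_tight_minors:
  fixes A :: "'a set"
  assumes cl: "closed_superpositions A \<R>"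
  shows "closed_tight_minors_at TYPE('j) TYPE('v) A \<R>"
  unfolding closed_tight_minors_at_def
proof (intro allI impI)
  fix m :: nat and V :: "'v set" and J :: "'j set" and n h R
  assume asm: "0 < m \<and> J \<noteq> {} \<and>
    (\<forall>j\<in>J. 0 < n j \<and> h j \<in> tuples ({..<m} <+> V) (n j) \<and> R j \<in> \<R> \<and> R j \<subseteq> tuples A (n j))"
  \<comment> \<open>Since m is positive, the base set is non-empty even if \<open>V\<close> is
    empty.\<close>
  have "{..<m} <+> V \<noteq> {}" "map Inl [0..<m] \<in> tuples ({..<m} <+> V) m"
    using asm by (auto simp: tuples_def)
  hence "general_superposition A ({..<m} <+> V) (map Inl [0..<m]) J h R \<in> \<R>"
    using asm closed_superpositions_imp_at[OF cl, where 'j='j and 'b="nat + 'v",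
      unfolded closed_superpositions_at_def, rule_format,
      of m "{..<m} <+> V" "map Inl [0..<m]" J n h R] by blast
  thus "tight_minor A m V J h R \<in> \<R>"
    using tight_minor_eq_general_superposition[of J h m V n A R] asm by simp
qed

theorem theorem6:
  fixes A :: "'a set" and \<R> :: "'a list set set"
  assumes "A \<noteq> {}"
    and "\<forall>R\<in>\<R>. relation_on A R"
    and "locally_closed A \<R>"
    and "{} \<in> \<R>"
  shows "(equality_rel A \<in> \<R> \<and> closed_tight_minors A \<R>) \<longleftrightarrow>
         (tuples A 1 \<in> \<R> \<and> closed_superpositions A \<R>)"
proof
  assume "equality_rel A \<in> \<R> \<and> closed_tight_minors A \<R>"
  thus "tuples A 1 \<in> \<R> \<and> closed_superpositions A \<R>"
    \<comment> \<open>Closure is by definition closure at one fixed pair of types, an instance of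
      the lemmas above.\<close>
    unfolding closed_superpositions_def
    using closed_tight_minors_imp_full_unary closed_tight_minors_imp_superpositions by blast
next
  assume "tuples A 1 \<in> \<R> \<and> closed_superpositions A \<R>"
  thus "equality_rel A \<in> \<R> \<and> closed_tight_minors A \<R>"
    unfolding closed_tight_minors_def
    using closed_superpositions_imp_equality closed_superpositions_imp_tight_minors by blast
qed

end
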